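(* For $\alpha\in(0,1)$ and $S,\tilde S\in\mathcal{S}$, $$D_{\alpha}[\,S:\tilde S\,]=\frac{1}{1-\alpha}\min_{S'\in\mathcal{S}}\Big\{\alpha\,D_{\mathrm{IS}}[\,\tilde S:S'\,]+(1-\alpha)\,D_{\mathrm{IS}}[\,S:S'\,]\Big\},$$ where the minimum is achieved by $\underline{S}:=\alpha\tilde S+(1-\alpha)S$. The same characterization holds for the discrete version: for each $n$, $$D^{(n)}_{\alpha}[\,S:\tilde S\,]=\frac{1}{1-\alpha}\min_{S'\in\mathcal{S}}\Big\{\alpha\,D^{(n)}_{\mathrm{IS}}[\,\tilde S:S'\,]+(1-\alpha)\,D^{(n)}_{\mathrm{IS}}[\,S:S'\,]\Big\},$$ with the minimum achieved by $\underline{S}$.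
   Context: $\mathcal{S}$ is the set of functions $S:[-\pi,\pi]\to[0,\infty]$ such that $\int_{-\pi}^{\pi}S(\omega)\,d\omega<\infty$, and $S(\omega)>0$ and $S(\omega)=S(-\omega)$ for all $\omega\in(0,\pi)$. For $\alpha\in(0,1)$ the spectral $\alpha$-Rényi divergence is $$D_{\alpha}[\,S:\tilde S\,]=\frac{1}{2\pi(1-\alpha)}\int_{-\pi}^{\pi}\Big[\log\{\alpha\tilde S(\omega)+(1-\alpha)S(\omega)\}-\alpha\log\tilde S(\omega)-(1-\alpha)\log S(\omega)\Big]\,d\omega,$$ and the Itakura–Saito divergence is $$D_{\mathrm{IS}}[\,S:\tilde S\,]=\frac{1}{2\pi}\int_{-\pi}^{\pi}\left\{\left(\frac{\tilde S(\omega)}{S(\omega)}\right)^{-1}-1+\log\frac{\tilde S(\omega)}{S(\omega)}\right\}d\omega.$$ The integrands are nonnegative, and the divergences may take the value $+\infty$. The discrete versions are obtained by replacing $\frac{1}{2\pi}\int_{-\pi}^{\pi}\cdots\,d\omega$ with $\frac1n\sum_{\omega\in\Omega_n}\cdots$, where $\Omega_n=\{2\pi t/n: t=-\lceil n/2\rceil+1,\ldots,-1,0,1,\ldots,\lfloor n/2\rfloor\}$: $$D^{(n)}_{\alpha}[\,S:\tilde S\,]=\frac{1}{(1-\alpha)n}\sum_{\omega\in\Omega_n}\Big[\log\{\alpha\tilde S(\omega)+(1-\alpha)S(\omega)\}-\alpha\log\tilde S(\omega)-(1-\alpha)\log S(\omega)\Big],$$ $$D^{(n)}_{\mathrm{IS}}[\,S:\tilde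 S\,]=\frac1n\sum_{\omega\in\Omega_n}\left\{\left(\frac{\tilde S(\omega)}{S(\omega)}\right)^{-1}-1+\log\frac{\tilde S(\omega)}{S(\omega)}\right\}.$$ *)

theory Defs
  imports "HOL-Analysis.Analysis"
begin

text \<open>
  A spectral density is a total function on the reals; only its values on \<open>[-\<pi>, \<pi>]\<close> matter,
  since every functional below depends on nothing else.
\<close>

definition spectral_densities :: "(real \<Rightarrow> ennreal) set" where
  "spectral_densities =
     {S. S \<in> borel_measurable (lebesgue_on {-pi..pi})
       \<and> (\<integral>\<^sup>+ \<omega>. S \<omega> \<partial>lebesgue_on {-pi..pi}) < \<infinity>
       \<and> (\<forall>\<omega>\<in>{0<..<pi}. S \<omega> > 0 \<and> S \<omega> = S (- \<omega>))}"

definition ext_ln :: "ennreal \<Rightarrow> ereal" where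
  "ext_ln x = (if x = 0 then - \<infinity> else if x = \<infinity> then \<infinity> else ereal (ln (enn2real x)))"

text \<open>
  Densities may take the values \<open>0\<close> and \<open>\<infinity>\<close> at single frequencies, in particular at \<open>0\<close> and
  \<open>\<plusminus>\<pi>\<close>. The two integrands are therefore functions of a pair of extended values \<open>(s, t)\<close>:
  the formula is used with extended arithmetic, except at \<open>(0, 0)\<close> and \<open>(\<infinity>, \<infinity>)\<close>, where it is
  indeterminate and the integrand is set to \<open>0\<close> (its lower limit there, and its value at every
  other pair of equal arguments). At every other pair with an entry \<open>0\<close> or \<open>\<infinity>\<close> the
  integrand tends to \<open>\<infinity>\<close>, and this is also the value of the formula, because
  \<open>\<infinity> + (- \<infinity>) = \<infinity>\<close> in \<^typ>\<open>ereal\<close>; see the lemmas on boundary values below.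
\<close>

definition IS_integrand :: "ennreal \<Rightarrow> ennreal \<Rightarrow> ereal" where
  "IS_integrand s t =
     (if s = t \<and> (s = 0 \<or> s = \<infinity>) then 0
      else enn2ereal (inverse (t / s)) - 1 + ext_ln (t / s))"

definition Renyi_integrand :: "real \<Rightarrow> ennreal \<Rightarrow> ennreal \<Rightarrow> ereal" where
  "Renyi_integrand \<alpha> s t =
     (if s = t \<and> (s = 0 \<or> s = \<infinity>) then 0
      else ext_ln (ennreal \<alpha> * t + ennreal (1 - \<alpha>) * s)
             - ereal \<alpha> * ext_ln t - ereal (1 - \<alpha>) * ext_ln s)"

definition mixture :: "real \<Rightarrow> (real \<Rightarrow> ennreal) \<Rightarrow> (real \<Rightarrow> ennreal) \<Rightarrow> real \<Rightarrow> ennreal" where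
  "mixture \<alpha> S T = (\<lambda>\<omega>. ennreal \<alpha> * T \<omega> + ennreal (1 - \<alpha>) * S \<omega>)"

text \<open>
  The conversion \<^const>\<open>e2ennreal\<close> would cut off negative values, but both integrands are
  nonnegative (lemmas \<open>IS_integrand_nonneg\<close> and \<open>Renyi_integrand_nonneg\<close>).
\<close>

definition IS_div :: "(real \<Rightarrow> ennreal) \<Rightarrow> (real \<Rightarrow> ennreal) \<Rightarrow> ereal" where
  "IS_div S T =
     ereal (1 / (2 * pi)) *
       enn2ereal (\<integral>\<^sup>+ \<omega>. e2ennreal (IS_integrand (S \<omega>) (T \<omega>)) \<partial>lebesgue_on {-pi..pi})"

definition Renyi_div :: "real \<Rightarrow> (real \<Rightarrow> ennreal) \<Rightarrow> (real \<Rightarrow> ennreal) \<Rightarrow> ereal" where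
  "Renyi_div \<alpha> S T =
     ereal (1 / (2 * pi * (1 - \<alpha>))) *
       enn2ereal (\<integral>\<^sup>+ \<omega>. e2ennreal (Renyi_integrand \<alpha> (S \<omega>) (T \<omega>)) \<partial>lebesgue_on {-pi..pi})"

definition fourier_freqs :: "nat \<Rightarrow> real set" where
  "fourier_freqs n =
     (\<lambda>t::int. 2 * pi * of_int t / real n) ` {- \<lceil>real n / 2\<rceil> + 1 .. \<lfloor>real n / 2\<rfloor>}"

definition IS_div_discrete :: "nat \<Rightarrow> (real \<Rightarrow> ennreal) \<Rightarrow> (real \<Rightarrow> ennreal) \<Rightarrow> ereal" where
  "IS_div_discrete n S T =
     ereal (1 / real n) * (\<Sum>\<omega>\<in>fourier_freqs n. IS_integrand (S \<omega>) (T \<omega>))"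

definition Renyi_div_discrete ::
    "nat \<Rightarrow> real \<Rightarrow> (real \<Rightarrow> ennreal) \<Rightarrow> (real \<Rightarrow> ennreal) \<Rightarrow> ereal" where
  "Renyi_div_discrete n \<alpha> S T =
     ereal (1 / ((1 - \<alpha>) * real n)) *
       (\<Sum>\<omega>\<in>fourier_freqs n. Renyi_integrand \<alpha> (S \<omega>) (T \<omega>))"


lemma IS_integrand_real:
  assumes "0 < s" "0 < t"
  shows "IS_integrand (ennreal s) (ennreal t) = ereal (inverse (t / s) - 1 + ln (t / s))"
  using assms
  by (simp add: IS_integrand_def ext_ln_def divide_ennreal inverse_ennreal
      enn2ereal_ennreal one_ereal_def)

lemma Renyi_integrand_real:
  assumes "0 < \<alpha>" "\<alpha> < 1" "0 < s" "0 < t"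
  shows "Renyi_integrand \<alpha> (ennreal s) (ennreal t)
           = ereal (ln (\<alpha> * t + (1 - \<alpha>) * s) - \<alpha> * ln t - (1 - \<alpha>) * ln s)"
proof -
  have pos: "0 < \<alpha> * t + (1 - \<alpha>) * s"
    using assms by (simp add: add_pos_pos)
  have "ennreal \<alpha> * ennreal t + ennreal (1 - \<alpha>) * ennreal s = ennreal (\<alpha> * t + (1 - \<alpha>) * s)"
    using assms by (simp add: ennreal_mult)
  then show ?thesis
    using assms pos by (simp add: Renyi_integrand_def ext_ln_def del: ennreal_plus)
qed

lemma ennreal_boundary_cases:
  obtains "x = 0" | "x = \<infinity>" | r where "0 < r" "x = ennreal r"
proof (cases x)
  case (real r)
  then show ?thesis
    using that by (cases "r = 0") auto
qed (use that in simp)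

text \<open>Boundary values\<close>

lemma IS_integrand_boundary:
  assumes "s \<noteq> t" "s \<in> {0, \<infinity>} \<or> t \<in> {0, \<infinity>}"
  shows "IS_integrand s t = \<infinity>"
proof (cases s rule: ennreal_boundary_cases)
  case 1
  with assms show ?thesis
    by (simp add: IS_integrand_def ext_ln_def ennreal_divide_eq_top_iff)
next
  case 2
  with assms show ?thesis
    by (simp add: IS_integrand_def ext_ln_def ennreal_divide_top)
next
  case (3 r)
  with assms show ?thesis
    by (auto simp: IS_integrand_def ext_ln_def ennreal_top_divide)
qed

lemma Renyi_integrand_boundary:
  assumes "0 < \<alpha>" "\<alpha> < 1" "s \<noteq> t" "s \<in> {0, \<infinity>} \<or> t \<in> {0, \<infinity>}"
  shows "Renyi_integrand \<alpha> s t = \<infinity>"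
  using assms
  by (cases s rule: ennreal_boundary_cases; cases t rule: ennreal_boundary_cases)
    (auto simp: Renyi_integrand_def ext_ln_def ennreal_mult_top ennreal_top_mult)

lemma IS_integrand_nonneg: "0 \<le> IS_integrand s t"
proof (cases "s \<in> {0, \<infinity>} \<or> t \<in> {0, \<infinity>}")
  case True
  then show ?thesis
    using IS_integrand_boundary[of s t] by (cases "s = t") (auto simp: IS_integrand_def)
next
  case False
  then obtain a b where "0 < a" "s = ennreal a" "0 < b" "t = ennreal b"
    by (metis ennreal_boundary_cases insertCI)
  moreover have "- ln (b / a) \<le> inverse (b / a) - 1"
    using \<open>0 < a\<close> \<open>0 < b\<close> ln_le_minus_one[of "inverse (b / a)"] ln_inverse[of "b / a"] by simp
  ultimately show ?thesis
    by (simp add: IS_integrand_real)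
qed

lemma Renyi_integrand_nonneg:
  assumes "0 < \<alpha>" "\<alpha> < 1"
  shows "0 \<le> Renyi_integrand \<alpha> s t"
proof (cases "s \<in> {0, \<infinity>} \<or> t \<in> {0, \<infinity>}")
  case True
  then show ?thesis
    using Renyi_integrand_boundary[of \<alpha> s t] assms
    by (cases "s = t") (auto simp: Renyi_integrand_def)
next
  case False
  then obtain a b where ab: "0 < a" "s = ennreal a" "0 < b" "t = ennreal b"
    by (metis ennreal_boundary_cases insertCI)
  have "\<alpha> * ln b + (1 - \<alpha>) * ln a \<le> ln (\<alpha> * b + (1 - \<alpha>) * a)"
    using concave_onD[OF ln_concave, of \<alpha> a b] assms ab by (simp add: algebra_simps)
  then show ?thesis
    using ab assms by (simp add: Renyi_integrand_real)
qed

end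

theory Submission
  imports Defs
begin

text \<open>
  The function to be minimized splits into a constant and a term that can be made zero. At a
  single frequency with values \<open>s\<close>, \<open>t\<close> of the two densities and \<open>u\<close> of the competitor, put
  \<open>m = \<alpha> t + (1 - \<alpha>) s\<close>. Then

  \<open>\<alpha> (t / u - 1 + log (u / t)) + (1 - \<alpha>) (s / u - 1 + log (u / s))\<close>
  \<open>= (log m - \<alpha> log t - (1 - \<alpha>) log s) + (m / u - 1 + log (u / m))\<close>,

  since \<open>t\<close> and \<open>s\<close> meet \<open>u\<close> only in the linear term, where they combine to \<open>m / u\<close>. The first
  summand on the right is the Renyi integrand and does not involve \<open>u\<close>; the second is the
  Itakura-Saito integrand of \<open>m\<close> and \<open>u\<close>, which is nonnegative and vanishes at \<open>u = m\<close>.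

  The discrete divergences see single frequencies, so the values \<open>0\<close> and \<open>\<infinity>\<close> cannot be
  discarded as a null set; but the identity persists there (\<open>IS_integrand_compensation\<close>). It can
  then be integrated over \<open>[-\<pi>, \<pi>]\<close> (\<open>IS_div_compensation\<close>) and summed over the Fourier
  frequencies (\<open>IS_div_discrete_compensation\<close>). Either way the objective becomes \<open>1 - \<alpha>\<close> times the
  Renyi divergence plus the Itakura-Saito divergence of the mixture and the competitor. As the
  mixture is itself a spectral density (\<open>mixture_in_spectral_densities\<close>), it is a competitor, and
  it attains the minimum (\<open>minimum_of_offset\<close>).
\<close>

lemma IS_integrand_self [simp]: "IS_integrand s s = 0"
proof (cases s rule: ennreal_boundary_cases)
  case (3 r)
  then show ?thesis
    using IS_integrand_real[of r r] by (simp add: zero_ereal_def)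
qed (simp_all add: IS_integrand_def)

text \<open>
  For positive finite arguments this is algebra. The other cases are checked by hand: if \<open>s\<close> and
  \<open>t\<close> differ and one of them is \<open>0\<close> or \<open>\<infinity>\<close>, then \<open>u\<close> cannot match both, so both sides are
  infinite; if \<open>s = t\<close> is \<open>0\<close> or \<open>\<infinity>\<close>, then \<open>m = s\<close> and the weights add up to \<open>1\<close>; and if only \<open>u\<close>
  is \<open>0\<close> or \<open>\<infinity>\<close>, it matches none of \<open>s\<close>, \<open>t\<close> and \<open>m\<close>, and both sides are infinite again.
\<close>

lemma IS_integrand_compensation:
  assumes \<alpha>: "0 < \<alpha>" "\<alpha> < 1"
  shows "ereal \<alpha> * IS_integrand t u + ereal (1 - \<alpha>) * IS_integrand s u
           = Renyi_integrand \<alpha> s t + IS_integrand (ennreal \<alpha> * t + ennreal (1 - \<alpha>) * s) u"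
proof -
  let ?m = "ennreal \<alpha> * t + ennreal (1 - \<alpha>) * s"
  have weights: "ereal \<alpha> * x + ereal (1 - \<alpha>) * x = x" if "0 \<le> x" for x
    using that \<alpha> by (cases x) (auto simp: algebra_simps)
  have infinite: "ereal \<alpha> * x + ereal (1 - \<alpha>) * y = \<infinity>"
    if "x = \<infinity> \<or> y = \<infinity>" "0 \<le> x" "0 \<le> y" for x y
    using that \<alpha> by (cases x; cases y) auto
  consider (boundary_eq) "s = t" "s \<in> {0, \<infinity>}"
    | (boundary_neq) "s \<noteq> t" "s \<in> {0, \<infinity>} \<or> t \<in> {0, \<infinity>}"
    | (interior) "s \<notin> {0, \<infinity>}" "t \<notin> {0, \<infinity>}"
    by blast
  then show ?thesis
  proof cases
    case boundary_eq
    then have "Renyi_integrand \<alpha> s t = 0" "?m = s"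
      using \<alpha> by (auto simp: Renyi_integrand_def ennreal_mult_top)
    then show ?thesis
      using boundary_eq weights[OF IS_integrand_nonneg] by simp
  next
    case boundary_neq
    have "IS_integrand t u = \<infinity> \<or> IS_integrand s u = \<infinity>"
      using boundary_neq IS_integrand_boundary[of t u] IS_integrand_boundary[of s u] by blast
    then show ?thesis
      using Renyi_integrand_boundary[OF \<alpha> boundary_neq] infinite IS_integrand_nonneg by simp
  next
    case interior
    then obtain a b where ab: "0 < a" "s = ennreal a" "0 < b" "t = ennreal b"
      by (metis ennreal_boundary_cases insertCI)
    define m where "m = \<alpha> * b + (1 - \<alpha>) * a"
    have m: "0 < m" "?m = ennreal m"
      using \<alpha> ab by (simp_all add: m_def add_pos_pos ennreal_mult)
    show ?thesis
    proof (cases "u \<in> {0, \<infinity>}")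
      case True
      then have "IS_integrand t u = \<infinity>" "IS_integrand ?m u = \<infinity>"
        unfolding m(2) using ab m(1) by (auto intro!: IS_integrand_boundary)
      then show ?thesis
        using \<alpha> infinite IS_integrand_nonneg Renyi_integrand_nonneg[OF \<alpha>, of s t] by simp
    next
      case False
      then obtain c where c: "0 < c" "u = ennreal c"
        by (metis ennreal_boundary_cases insertCI)
      have "\<alpha> * (inverse (c / b) - 1 + ln (c / b)) + (1 - \<alpha>) * (inverse (c / a) - 1 + ln (c / a))
              = (\<alpha> * b + (1 - \<alpha>) * a) / c - 1 + ln c - \<alpha> * ln b - (1 - \<alpha>) * ln a"
        using ab c by (simp add: ln_div field_simps)
      also have "\<dots> = (ln m - \<alpha> * ln b - (1 - \<alpha>) * ln a) + (inverse (c / m) - 1 + ln (c / m))"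
        using c m(1) by (simp add: ln_div m_def[symmetric])
      finally show ?thesis
        unfolding m(2) using \<alpha> ab c m(1)
        by (simp add: IS_integrand_real Renyi_integrand_real m_def[symmetric])
    qed
  qed
qed

lemma measurable_ext_ln [measurable]: "ext_ln \<in> borel_measurable borel"
  unfolding ext_ln_def[abs_def] by measurable

lemma measurable_IS_integrand [measurable]:
  assumes [measurable]: "f \<in> borel_measurable M" "g \<in> borel_measurable M"
  shows "(\<lambda>x. IS_integrand (f x) (g x)) \<in> borel_measurable M"
  unfolding IS_integrand_def divide_ennreal_def by measurable

lemma measurable_Renyi_integrand [measurable]:
  assumes [measurable]: "f \<in> borel_measurable M" "g \<in> borel_measurable M"
  shows "(\<lambda>x. Renyi_integrand \<alpha> (f x) (g x)) \<in> borel_measurable M"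
  unfolding Renyi_integrand_def by measurable

lemma spectral_densities_measurable:
  "S \<in> spectral_densities \<Longrightarrow> S \<in> borel_measurable (lebesgue_on {-pi..pi})"
  by (simp add: spectral_densities_def)

lemma mixture_measurable [measurable]:
  assumes [measurable]: "S \<in> borel_measurable M" "T \<in> borel_measurable M"
  shows "mixture \<alpha> S T \<in> borel_measurable M"
  unfolding mixture_def by measurable

lemma mixture_in_spectral_densities:
  assumes "0 < \<alpha>" "\<alpha> < 1" "S \<in> spectral_densities" "T \<in> spectral_densities"
  shows "mixture \<alpha> S T \<in> spectral_densities"
proof -
  let ?L = "lebesgue_on {-pi..pi}"
  have [measurable]: "S \<in> borel_measurable ?L" "T \<in> borel_measurable ?L"
    using assms spectral_densities_measurable by blast+
  have "(\<integral>\<^sup>+ \<omega>. mixture \<alpha> S T \<omega> \<partial>?L)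
          = ennreal \<alpha> * (\<integral>\<^sup>+ \<omega>. T \<omega> \<partial>?L) + ennreal (1 - \<alpha>) * (\<integral>\<^sup>+ \<omega>. S \<omega> \<partial>?L)"
    by (simp add: mixture_def nn_integral_add nn_integral_cmult)
  also have "\<dots> < \<infinity>"
    using assms by (simp add: spectral_densities_def ennreal_mult_less_top)
  finally have "(\<integral>\<^sup>+ \<omega>. mixture \<alpha> S T \<omega> \<partial>?L) < \<infinity>" .
  moreover have "0 < mixture \<alpha> S T \<omega> \<and> mixture \<alpha> S T \<omega> = mixture \<alpha> S T (- \<omega>)"
    if "\<omega> \<in> {0<..<pi}" for \<omega>
  proof -
    have "0 < S \<omega>" "S \<omega> = S (- \<omega>)" "T \<omega> = T (- \<omega>)"
      using that assms unfolding spectral_densities_def by blast+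
    then show ?thesis
      using assms(2) unfolding mixture_def
      by (metis add_nonneg_pos diff_gt_0_iff_gt ennreal_less_zero_iff ennreal_zero_less_mult_iff
          zero_le)
  qed
  moreover have "mixture \<alpha> S T \<in> borel_measurable ?L"
    by measurable
  ultimately show ?thesis
    unfolding spectral_densities_def by blast
qed

lemma ereal_convex_comb_scale:
  assumes "0 \<le> (x::ereal)" "0 \<le> y" "0 \<le> p" "0 \<le> q"
  shows "ereal p * (ereal c * x) + ereal q * (ereal c * y) = ereal c * (ereal p * x + ereal q * y)"
  using assms by (simp add: ereal_right_distrib mult.left_commute)

text \<open>
  The integral is taken in \<^typ>\<open>ennreal\<close>, where it is additive for all measurable integrands, so the
  identity also covers infinite divergences.
\<close>

lemma IS_div_compensation:
  assumes \<alpha>: "0 < \<alpha>" "\<alpha> < 1"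
    and "S \<in> spectral_densities" "T \<in> spectral_densities" "U \<in> spectral_densities"
  shows "ereal \<alpha> * IS_div T U + ereal (1 - \<alpha>) * IS_div S U
           = ereal (1 - \<alpha>) * Renyi_div \<alpha> S T + IS_div (mixture \<alpha> S T) U"
proof -
  let ?L = "lebesgue_on {-pi..pi}"
  let ?I = "\<lambda>A. \<integral>\<^sup>+ \<omega>. e2ennreal (IS_integrand (A \<omega>) (U \<omega>)) \<partial>?L"
  let ?R = "\<integral>\<^sup>+ \<omega>. e2ennreal (Renyi_integrand \<alpha> (S \<omega>) (T \<omega>)) \<partial>?L"
  have [measurable]:
    "S \<in> borel_measurable ?L" "T \<in> borel_measurable ?L" "U \<in> borel_measurable ?L"
    using assms spectral_densities_measurable by blast+
  have pointwise: "ennreal \<alpha> * e2ennreal (IS_integrand t u)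
                     + ennreal (1 - \<alpha>) * e2ennreal (IS_integrand s u)
                   = e2ennreal (Renyi_integrand \<alpha> s t)
                     + e2ennreal (IS_integrand (ennreal \<alpha> * t + ennreal (1 - \<alpha>) * s) u)" for s t u
    using IS_integrand_compensation[OF \<alpha>, of t u s] \<alpha>
    by (intro enn2ereal_inject[THEN iffD1])
      (simp add: plus_ennreal.rep_eq times_ennreal.rep_eq enn2ereal_e2ennreal
        IS_integrand_nonneg Renyi_integrand_nonneg)
  have "ennreal \<alpha> * ?I T + ennreal (1 - \<alpha>) * ?I S = ?R + ?I (mixture \<alpha> S T)"
    using pointwise by (simp add: nn_integral_add[symmetric] nn_integral_cmult[symmetric] mixture_def)
  from arg_cong[OF this, of enn2ereal]
  have "ereal \<alpha> * enn2ereal (?I T) + ereal (1 - \<alpha>) * enn2ereal (?I S)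
          = enn2ereal ?R + enn2ereal (?I (mixture \<alpha> S T))"
    using \<alpha> by (simp only: plus_ennreal.rep_eq times_ennreal.rep_eq enn2ereal_ennreal
        less_imp_le diff_ge_0_iff_ge)
  moreover have "ereal (1 - \<alpha>) * Renyi_div \<alpha> S T = ereal (1 / (2 * pi)) * enn2ereal ?R"
    using \<alpha> by (simp add: Renyi_div_def mult.assoc[symmetric])
  ultimately show ?thesis
    using \<alpha> by (simp add: IS_div_def ereal_convex_comb_scale ereal_right_distrib)
qed

lemma IS_div_discrete_compensation:
  assumes \<alpha>: "0 < \<alpha>" "\<alpha> < 1"
  shows "ereal \<alpha> * IS_div_discrete n T U + ereal (1 - \<alpha>) * IS_div_discrete n S U
           = ereal (1 - \<alpha>) * Renyi_div_discrete n \<alpha> S T + IS_div_discrete n (mixture \<alpha> S T) U"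
proof -
  let ?I = "\<lambda>A. \<Sum>\<omega>\<in>fourier_freqs n. IS_integrand (A \<omega>) (U \<omega>)"
  let ?R = "\<Sum>\<omega>\<in>fourier_freqs n. Renyi_integrand \<alpha> (S \<omega>) (T \<omega>)"
  have I_nonneg: "0 \<le> ?I A" for A
    by (intro sum_nonneg IS_integrand_nonneg)
  have R_nonneg: "0 \<le> ?R"
    using \<alpha> by (intro sum_nonneg Renyi_integrand_nonneg)
  have "ereal \<alpha> * ?I T + ereal (1 - \<alpha>) * ?I S = ?R + ?I (mixture \<alpha> S T)"
    using IS_integrand_compensation[OF \<alpha>]
    by (simp add: sum_ereal_right_distrib IS_integrand_nonneg sum.distrib[symmetric] mixture_def)
  moreover have "ereal (1 - \<alpha>) * Renyi_div_discrete n \<alpha> S T = ereal (1 / real n) * ?R"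
    using \<alpha> by (simp add: Renyi_div_discrete_def mult.assoc[symmetric])
  ultimately show ?thesis
    using \<alpha> I_nonneg R_nonneg
    by (simp add: IS_div_discrete_def ereal_convex_comb_scale ereal_right_distrib)
qed

lemma IS_div_nonneg: "0 \<le> IS_div S T"
  by (simp add: IS_div_def)

lemma IS_div_self: "IS_div S S = 0"
  by (simp add: IS_div_def zero_ennreal.rep_eq zero_ennreal_def[symmetric])

lemma IS_div_discrete_nonneg: "0 \<le> IS_div_discrete n S T"
  unfolding IS_div_discrete_def
  by (intro ereal_0_le_mult sum_nonneg IS_integrand_nonneg) simp

lemma IS_div_discrete_self: "IS_div_discrete n S S = 0"
  by (simp add: IS_div_discrete_def)

lemma minimum_of_offset:
  fixes F D :: "'a \<Rightarrow> ereal"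
  assumes F: "\<And>x. x \<in> A \<Longrightarrow> F x = r + D x"
    and D: "\<And>x. x \<in> A \<Longrightarrow> 0 \<le> D x" and m: "m \<in> A" "D m = 0"
  shows "(INF x\<in>A. F x) = r" "is_arg_min F (\<lambda>x. x \<in> A) m"
proof -
  have Fm: "F m = r"
    using F m by simp
  have lower: "r \<le> F x" if "x \<in> A" for x
    using F D that add_left_mono[of 0 "D x" r] by simp
  show "(INF x\<in>A. F x) = r"
    using Fm lower m by (intro antisym INF_greatest) (auto intro: INF_lower2)
  show "is_arg_min F (\<lambda>x. x \<in> A) m"
    using Fm lower m by (auto simp: is_arg_min_def not_less)
qed

theorem theorem2:
  fixes \<alpha> :: real and S T :: "real \<Rightarrow> ennreal"
  assumes "0 < \<alpha>" and "\<alpha> < 1"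
    and "S \<in> spectral_densities" and "T \<in> spectral_densities"
  shows "(Renyi_div \<alpha> S T =
            ereal (1 / (1 - \<alpha>)) *
              (INF S'\<in>spectral_densities.
                 ereal \<alpha> * IS_div T S' + ereal (1 - \<alpha>) * IS_div S S')
          \<and> is_arg_min (\<lambda>S'. ereal \<alpha> * IS_div T S' + ereal (1 - \<alpha>) * IS_div S S')
              (\<lambda>S'. S' \<in> spectral_densities) (mixture \<alpha> S T))
       \<and> (\<forall>n\<ge>1.
            Renyi_div_discrete n \<alpha> S T =
              ereal (1 / (1 - \<alpha>)) *
                (INF S'\<in>spectral_densities.
                   ereal \<alpha> * IS_div_discrete n T S' + ereal (1 - \<alpha>) * IS_div_discrete n S S')
          \<and> is_arg_min
              (\<lambda>S'. ereal \<alpha> * IS_div_discrete n T S' + ereal (1 - \<alpha>) * IS_div_discrete n S S')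
              (\<lambda>S'. S' \<in> spectral_densities) (mixture \<alpha> S T))"
proof -
  let ?m = "mixture \<alpha> S T"
  have m: "?m \<in> spectral_densities"
    using assms by (rule mixture_in_spectral_densities)
  have cancel: "ereal (1 / (1 - \<alpha>)) * (ereal (1 - \<alpha>) * x) = x" for x
    using assms(2) by (simp add: mult.assoc[symmetric] one_ereal_def[symmetric])
  note continuous = minimum_of_offset[of spectral_densities _ _ "IS_div ?m" ?m,
      OF IS_div_compensation[OF assms] IS_div_nonneg m IS_div_self]
  note discrete = minimum_of_offset[of spectral_densities _ _ "IS_div_discrete n ?m" ?m for n,
      OF IS_div_discrete_compensation[OF assms(1,2)] IS_div_discrete_nonneg m IS_div_discrete_self]
  show ?thesis
    by (simp only: continuous discrete cancel simp_thms)
qed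

end
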